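(* Let $X$ be a real Banach space with $\operatorname{dens}(X)=\omega_1$. The following assertions are equivalent: (1) $X$ has the Daugavet property, that is, for every $x\in S_X$, every non-empty relatively weakly open subset $W$ of $B_X$ and every $\varepsilon>0$ there exists $y\in W$ such that $\Vert x+y\Vert>2-\varepsilon$. (2) For every non-empty relatively weak-star open subset $W$ of $B_{X^{**}}$ there exists $v\in S_{X^{**}}\cap W$ such that $$\Vert x+v\Vert=1+\Vert x\Vert$$ holds for every $x\in X$.
   Context: All Banach spaces are real. $B_X$ and $S_X$ denote the closed unit ball and the unit sphere of $X$; $\operatorname{dens}(X)$ is the density character of $X$ and $\omega_1$ the first uncountable ordinal. $X$ is regarded as a subspace of $X^{**}$ through the canonical embedding, and the weak-star topology on $X^{**}$ is $\sigma(X^{**},X^* )$. The Daugavet property of $X$ is usually defined by requiring $\Vert T+I\Vert=1+\Vert T\Vert$ for every bounded rank-one operator $T:X\to X$, where $I$ is the identity operator; the formulation in (1) is an equivalent one. *)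

theory Defs
  imports "HOL-Analysis.Analysis"
begin

unbundle cardinal_syntax

definition dens :: "'a::topological_space itself \<Rightarrow> 'a rel" where
  "dens _ = |SOME D :: 'a set. closure D = UNIV \<and> (\<forall>E :: 'a set. closure E = UNIV \<longrightarrow> |D| \<le>o |E| )|"

text \<open>The choice in the definition is well defined: a dense set of least cardinality exists.\<close>

lemma dens_attained:
  obtains D :: "'a::topological_space set"
  where "closure D = UNIV" "dens TYPE('a) = |D|"
    "\<And>E :: 'a set. closure E = UNIV \<Longrightarrow> |D| \<le>o |E|"
proof -
  have "card_of (UNIV :: 'a set) \<in> card_of ` {D :: 'a set. closure D = UNIV}"
    by simp
  then obtain r where r: "r \<in> card_of ` {D :: 'a set. closure D = UNIV}"
    and least: "\<And>s. s <o r \<Longrightarrow> s \<notin> card_of ` {D :: 'a set. closure D = UNIV}"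
    using wfE_min[OF wf_ordLess] by metis
  from r obtain C :: "'a set" where C: "closure C = UNIV" "r = |C|"
    by auto
  have "|C| \<le>o |E|" if "closure E = UNIV" for E :: "'a set"
    using least[of "|E|"] that C not_ordLess_iff_ordLeq[OF card_of_Well_order card_of_Well_order, of E C]
    by auto
  with C(1) have ex: "\<exists>D :: 'a set. closure D = UNIV \<and> (\<forall>E :: 'a set. closure E = UNIV \<longrightarrow> |D| \<le>o |E| )"
    by blast
  show thesis
    using someI_ex[OF ex] by (intro that[OF _ dens_def]) blast+
qed

text \<open>\<open>natLeq\<close> is the order type of the natural numbers, so this is the first uncountable cardinal.\<close>

definition omega1 :: "nat set rel" where
  "omega1 = cardSuc natLeq"

type_synonym 'a dual = "'a \<Rightarrow>\<^sub>L real"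
type_synonym 'a bidual = "'a dual dual"

text \<open>A function type carries the product topology, so this is the coarsest topology on the space
  for which every continuous linear functional is continuous.\<close>

definition weak_topology :: "'a::real_normed_vector topology" where
  "weak_topology = pullback_topology UNIV (\<lambda>x (f :: 'a dual). blinfun_apply f x) euclidean"

text \<open>For scalar-valued operators the strong operator topology is the topology of pointwise
  convergence, which on the bidual is \<open>\<sigma>(X**, X* )\<close>.\<close>

abbreviation weak_star_topology :: "'a::real_normed_vector bidual topology" where
  "weak_star_topology \<equiv> strong_operator_topology"

definition canonical_embedding :: "'a::real_normed_vector \<Rightarrow> 'a bidual" where
  "canonical_embedding x = Blinfun (\<lambda>f. blinfun_apply f x)"

lemma canonical_embedding_apply [simp]:
  "blinfun_apply (canonical_embedding x) f = blinfun_apply f x"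
  unfolding canonical_embedding_def
  by (subst bounded_linear_Blinfun_apply) (auto intro: blinfun.bounded_linear_left)

definition daugavet_property :: "'a::real_normed_vector itself \<Rightarrow> bool" where
  "daugavet_property _ \<longleftrightarrow>
    (\<forall>x \<in> sphere (0 :: 'a) 1. \<forall>W. openin (subtopology weak_topology (cball 0 1)) W \<and> W \<noteq> {} \<longrightarrow>
      (\<forall>\<epsilon> > 0. \<exists>y \<in> W. norm (x + y) > 2 - \<epsilon>))"

end

theory Submission
  imports Defs "HOL-Library.Countable_Set_Type"
begin

text \<open>
Call \<open>v\<close> in the unit ball of the bidual L-orthogonal to \<open>x\<close> if \<open>norm (x + v) = 1 + norm x\<close>.

From L-orthogonality to the Daugavet property one only has to approximate: an L-orthogonal \<open>v\<close> in a
weak-star neighbourhood is replaced by a point of the space by Goldstine's theorem, at the finitely many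
functionals that matter (\<open>L_orthogonal_imp_daugavet\<close>).

For the converse, a well-ordered list of \<open>\<omega>\<^sub>1\<close> conditions has to be met by a single \<open>v\<close>: for each
\<open>d\<close> in a dense set and each tolerance \<open>\<epsilon>\<close>, that \<open>norm (d + v) \<ge> 1 + norm d - \<epsilon>\<close>.  By the Daugavet
property each condition defines a weak-star dense set, but Baire category only handles countably many of these.  What helps is
that one condition can be secured by fixing the value of \<open>v\<close> at one functional \<open>g\<close> in the unit ball,
with \<open>v g + g d \<ge> 1 + norm d - \<epsilon>\<close>.  Before each stage only countably many stages have passed, so only
countably many values are fixed.  Hence the recursion goes through if any countable set of values that
is taken by some functional of the unit ball leaves enough freedom for the next condition.  That is
\<open>L_orthogonal_extension\<close>, where the Daugavet property is used: it yields a sequence in the unit ball whose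
values converge to the prescribed ones and which together with \<open>d\<close> almost behaves like
the unit vector basis of \<open>\<ell>\<^sub>1\<close> on positive combinations, and every weak-star cluster point of such a sequence meets the condition.
Before each stage, and at the end, weak-star compactness provides a functional with all the values fixed so
far (\<open>agreement_chain_Inter_nonempty\<close>); the recursion itself is \<open>transfinite_intersection\<close>.

Compactness enters only through \<open>generalized_limit\<close>, a consequence of the Hahn-Banach theorem, whose proof
here rests on the observation that a minimal sublinear functional is linear (\<open>sublinear_tilt\<close>).
\<close>

section \<open>Hahn-Banach and generalized limits\<close>

definition sublinear :: "('b::real_vector \<Rightarrow> real) \<Rightarrow> bool" where
  "sublinear p \<longleftrightarrow> (\<forall>x y. p (x + y) \<le> p x + p y) \<and> (\<forall>c>0. \<forall>x. p (c *\<^sub>R x) \<le> c * p x)"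

lemma sublinear_add: "sublinear p \<Longrightarrow> p (x + y) \<le> p x + p y"
  by (simp add: sublinear_def)

lemma sublinear_scale:
  assumes "sublinear p" "c > 0"
  shows "p (c *\<^sub>R x) = c * p x"
proof (rule antisym)
  show "p (c *\<^sub>R x) \<le> c * p x"
    using assms by (simp add: sublinear_def)
  have "p ((1 / c) *\<^sub>R (c *\<^sub>R x)) \<le> (1 / c) * p (c *\<^sub>R x)"
    using assms unfolding sublinear_def by (meson zero_less_divide_1_iff)
  then show "c * p x \<le> p (c *\<^sub>R x)"
    using assms by (simp add: field_simps)
qed

lemma sublinear_zero:
  assumes "sublinear p"
  shows "p 0 = 0"
  using sublinear_scale[OF assms, of 2 0] by simp

lemma sublinear_ge_uminus:
  assumes "sublinear p"
  shows "- p (- x) \<le> p x"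
  using sublinear_add[OF assms, of x "- x"] sublinear_zero[OF assms] by simp

lemma sublinear_norm: "sublinear (norm :: 'b::real_normed_vector \<Rightarrow> real)"
  by (simp add: sublinear_def norm_triangle_ineq)

text \<open>Tilting: lowering \<open>p\<close> in the direction \<open>- y\<close> as far as sublinearity allows.  A linear
  functional below the tilted \<open>q\<close> agrees with \<open>p\<close> at \<open>y\<close>.  A minimal \<open>p\<close> equals all its tilts, so that
  \<open>p (- y) = - p y\<close> for every \<open>y\<close>: this is the step from sublinear to linear in the Hahn-Banach theorem.\<close>

lemma sublinear_tilt:
  fixes p :: "'b::real_vector \<Rightarrow> real"
  assumes p: "sublinear p"
  obtains q where "sublinear q" "\<And>x. q x \<le> p x" "q (- y) \<le> - p y"
proof -
  define h where "h x t = p (x + t *\<^sub>R y) - t * p y" for x t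
  define q where "q x = (INF t\<in>{0..}. h x t)" for x
  have lower: "- p (- x) \<le> h x t" if "t \<ge> 0" for x t
  proof -
    have "t * p y = p (t *\<^sub>R y)"
      using that sublinear_scale[OF p, of t y] sublinear_zero[OF p] by (cases "t = 0") auto
    also have "\<dots> \<le> p (x + t *\<^sub>R y) + p (- x)"
      using sublinear_add[OF p, of "x + t *\<^sub>R y" "- x"] by simp
    finally show ?thesis by (simp add: h_def)
  qed
  have bdd: "bdd_below (h x ` {0..})" for x
    using lower[of _ x] by (intro bdd_belowI[of _ "- p (- x)"]) auto
  have q_le: "q x \<le> h x t" if "t \<ge> 0" for x t
    unfolding q_def using that by (intro cINF_lower bdd) auto
  have le_q: "c \<le> q x" if "\<And>t. t \<ge> 0 \<Longrightarrow> c \<le> h x t" for c x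
    unfolding q_def using that by (intro cINF_greatest) auto
  have sub: "q (x + z) \<le> q x + q z" for x z
  proof -
    have "q (x + z) - h z t \<le> q x" if t: "t \<ge> 0" for t
    proof (rule le_q)
      fix s :: real assume s: "s \<ge> 0"
      have "q (x + z) \<le> h (x + z) (s + t)"
        using s t by (intro q_le) auto
      also have "\<dots> \<le> h x s + h z t"
        using sublinear_add[OF p, of "x + s *\<^sub>R y" "z + t *\<^sub>R y"]
        by (simp add: h_def algebra_simps)
      finally show "q (x + z) - h z t \<le> h x s" by simp
    qed
    then have "q (x + z) - q x \<le> q z"
      by (intro le_q) (simp add: algebra_simps)
    then show ?thesis by simp
  qed
  have hom: "q (c *\<^sub>R x) \<le> c * q x" if c: "c > 0" for c x
  proof -
    have "q (c *\<^sub>R x) / c \<le> q x"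
    proof (rule le_q)
      fix t :: real assume t: "t \<ge> 0"
      have "q (c *\<^sub>R x) \<le> h (c *\<^sub>R x) (c * t)"
        using t c by (intro q_le) auto
      also have "\<dots> = c * h x t"
        using sublinear_scale[OF p c, of "x + t *\<^sub>R y"] by (simp add: h_def algebra_simps)
      finally show "q (c *\<^sub>R x) / c \<le> h x t"
        using c by (simp add: field_simps)
    qed
    then show ?thesis using c by (simp add: field_simps)
  qed
  show thesis
  proof
    show "sublinear q" using sub hom by (simp add: sublinear_def)
    show "q x \<le> p x" for x using q_le[of 0 x] by (simp add: h_def)
    show "q (- y) \<le> - p y"
      using q_le[of 1 "- y"] sublinear_zero[OF p] by (simp add: h_def)
  qed
qed

theorem Hahn_Banach_sublinear:
  fixes p :: "'b::real_vector \<Rightarrow> real"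
  assumes p: "sublinear p"
  obtains l where "linear l" "\<And>x. l x \<le> p x"
proof -
  define A where "A = {q. sublinear q \<and> (\<forall>x. q x \<le> p x)}"
  define P where "P q r \<longleftrightarrow> r \<le> q" for q r :: "'b \<Rightarrow> real"
  have "\<exists>m\<in>A. \<forall>a\<in>A. P m a \<longrightarrow> a = m"
  proof (rule predicate_Zorn)
    show "partial_order_on A (relation_of P A)"
      by (rule partial_order_on_relation_ofI) (auto simp: P_def)
    fix C assume C: "C \<in> Chains (relation_of P A)"
    then have CA: "C \<subseteq> A"
      by (auto simp: Chains_def relation_of_def)
    have tot: "P a b \<or> P b a" if "a \<in> C" "b \<in> C" for a b
      using C that by (auto simp: Chains_def relation_of_def)
    show "\<exists>u\<in>A. \<forall>a\<in>C. P a u"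
    proof (cases "C = {}")
      case True
      then show ?thesis using p by (auto simp: A_def)
    next
      case False
      define u where "u x = (INF q\<in>C. q x)" for x
      have lower: "- p (- x) \<le> q x" if "q \<in> C" for q x
      proof -
        have q: "sublinear q" "q (- x) \<le> p (- x)"
          using that CA by (auto simp: A_def)
        then show ?thesis using sublinear_ge_uminus[OF q(1), of x] by linarith
      qed
      have bdd: "bdd_below ((\<lambda>q. q x) ` C)" for x
        using lower by (intro bdd_belowI[of _ "- p (- x)"]) auto
      have u_le: "u x \<le> q x" if "q \<in> C" for q x
        unfolding u_def using that by (intro cINF_lower bdd) auto
      have le_u: "c \<le> u x" if "\<And>q. q \<in> C \<Longrightarrow> c \<le> q x" for c x
        unfolding u_def using that False by (intro cINF_greatest) auto
      have CS: "sublinear q" if "q \<in> C" for q using that CA by (auto simp: A_def)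
      have sub: "u (x + y) \<le> u x + u y" for x y
      proof -
        have "u (x + y) - r y \<le> u x" if r: "r \<in> C" for r
        proof (rule le_u)
          fix q assume q: "q \<in> C"
          \<comment> \<open>the smaller of the two members of the chain bounds both terms\<close>
          have "\<exists>s\<in>C. s x \<le> q x \<and> s y \<le> r y"
            using tot[OF q r] q r by (auto simp: P_def le_fun_def)
          then obtain s where s: "s \<in> C" "s x \<le> q x" "s y \<le> r y" by blast
          show "u (x + y) - r y \<le> q x"
            using u_le[OF s(1), of "x + y"] sublinear_add[OF CS[OF s(1)], of x y] s(2,3)
            by linarith
        qed
        then have "u (x + y) - u x \<le> u y" by (intro le_u) (simp add: algebra_simps)
        then show ?thesis by simp
      qed
      have hom: "u (c *\<^sub>R x) \<le> c * u x" if c: "c > 0" for c x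
      proof -
        have "u (c *\<^sub>R x) / c \<le> u x"
        proof (rule le_u)
          fix q assume q: "q \<in> C"
          show "u (c *\<^sub>R x) / c \<le> q x"
            using u_le[OF q, of "c *\<^sub>R x"] sublinear_scale[OF CS[OF q] c, of x] c
            by (simp add: field_simps)
        qed
        then show ?thesis using c by (simp add: field_simps)
      qed
      obtain q where q: "q \<in> C" using False by blast
      have "u x \<le> p x" for x
        using order_trans[OF u_le[OF q]] q CA by (auto simp: A_def)
      then have "u \<in> A" using sub hom by (auto simp: A_def sublinear_def)
      then show ?thesis using u_le by (auto simp: P_def le_fun_def)
    qed
  qed
  then obtain m where m: "m \<in> A" and min: "\<And>a. a \<in> A \<Longrightarrow> P m a \<Longrightarrow> a = m" by blast
  have sm: "sublinear m" and mp: "m x \<le> p x" for x using m by (auto simp: A_def)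
  have odd: "m (- y) = - m y" for y
  proof -
    obtain q where q: "sublinear q" "\<And>x. q x \<le> m x" "q (- y) \<le> - m y"
      using sublinear_tilt[OF sm, of y] by blast
    have "q = m"
      by (rule min) (use q mp in \<open>auto simp: A_def P_def le_fun_def intro: order_trans\<close>)
    then show ?thesis
      using q(3) sublinear_ge_uminus[OF sm, of y] by simp
  qed
  have add: "m (x + y) = m x + m y" for x y
    using sublinear_add[OF sm, of x y] sublinear_add[OF sm, of "- x" "- y"] odd[of "x + y"]
      odd[of x] odd[of y] by simp
  have "m (c *\<^sub>R x) = c *\<^sub>R m x" for c x
  proof (cases c "0::real" rule: linorder_cases)
    case less
    then show ?thesis
      using sublinear_scale[OF sm, of "- c" x] odd[of "c *\<^sub>R x"] by simp
  qed (use sublinear_scale[OF sm] sublinear_zero[OF sm] in auto)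
  then have "linear m" using add by (intro linearI) auto
  then show thesis using mp that by blast
qed

lemma dominated_functional:
  fixes p :: "'b::real_normed_vector \<Rightarrow> real"
  assumes "sublinear p" "\<And>x. p x \<le> norm x"
  obtains f :: "'b dual" where "norm f \<le> 1" "\<And>x. f x \<le> p x"
proof -
  obtain l where l: "linear l" "\<And>x. l x \<le> p x"
    using Hahn_Banach_sublinear[OF assms(1)] by blast
  have "\<bar>l x\<bar> \<le> norm x" for x
    using l(2)[of x] l(2)[of "- x"] assms(2)[of x] assms(2)[of "- x"] linear_neg[OF l(1), of x]
    by simp
  then have bl: "bounded_linear l"
    using l(1) by (intro bounded_linear_intro[where K = 1]) (auto simp: linear_add linear_scale)
  show thesis
  proof
    show "norm (Blinfun l) \<le> 1"
      using bl \<open>\<And>x. \<bar>l x\<bar> \<le> norm x\<close>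
      by (intro norm_blinfun_bound) (auto simp: bounded_linear_Blinfun_apply)
    show "blinfun_apply (Blinfun l) x \<le> p x" for x
      using bl l(2) by (simp add: bounded_linear_Blinfun_apply)
  qed
qed

lemma norming_functional:
  fixes y :: "'b::real_normed_vector"
  obtains f :: "'b dual" where "norm f \<le> 1" "f y = norm y"
proof -
  obtain q where q: "sublinear q" "\<And>x. q x \<le> norm x" "q (- y) \<le> - norm y"
    using sublinear_tilt[OF sublinear_norm, of y] by blast
  obtain f :: "'b dual" where f: "norm f \<le> 1" "\<And>x. f x \<le> q x"
    using dominated_functional[OF q(1,2)] by blast
  have "f y \<ge> norm y"
    using f(2)[of "- y"] q(3) by (simp add: blinfun.minus_right)
  moreover have "f y \<le> norm y"
    using f(2) q(2) by (rule order_trans)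
  ultimately show thesis using f(1) that by force
qed

lemma dual_apply_le:
  fixes f :: "'b::real_normed_vector dual"
  assumes "norm f \<le> 1"
  shows "f x \<le> norm x"
  using norm_blinfun[of f x] mult_right_mono[OF assms norm_ge_zero[of x]]
  by (simp add: real_norm_def)

lemma dual_norm_le:
  fixes f :: "'b::real_normed_vector dual"
  assumes le: "\<And>z. norm z \<le> 1 \<Longrightarrow> f z \<le> c"
  shows "norm f \<le> c"
proof (rule norm_blinfun_bound)
  show "0 \<le> c"
    using le[of 0] by (simp add: blinfun.zero_right)
  fix x
  show "norm (f x) \<le> c * norm x"
  proof (cases "x = 0")
    case False
    define z where "z = x /\<^sub>R norm x"
    have z: "norm z \<le> 1" and x: "x = norm x *\<^sub>R z" using False by (auto simp: z_def)
    have "\<bar>f z\<bar> \<le> c"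
      using le[of z] le[of "- z"] z by (simp add: blinfun.minus_right)
    moreover have "norm (f x) = \<bar>f z\<bar> * norm x"
      by (subst x) (simp add: blinfun.scaleR_right abs_mult)
    ultimately show ?thesis by (simp add: mult_right_mono)
  qed (simp add: blinfun.zero_right)
qed

text \<open>This does the work of the Banach-Alaoglu theorem.  The functional comes from Hahn-Banach,
  applied to the sublinear functional sending \<open>y\<close> to the upper limit of \<open>\<phi> y\<close> along the filter.
  Applying the conclusion to \<open>y\<close> and to \<open>- y\<close> squeezes the value of the limit.\<close>

lemma generalized_limit:
  fixes G :: "'b::real_normed_vector dual filter"
  assumes G: "G \<noteq> bot" and ball: "eventually (\<lambda>\<phi>. norm \<phi> \<le> 1) G"
  obtains v where "norm v \<le> 1"
    "\<And>y c. eventually (\<lambda>\<phi>. blinfun_apply \<phi> y \<le> c) G \<Longrightarrow> blinfun_apply v y \<le> c"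
proof -
  define S where "S y = {c. eventually (\<lambda>\<phi>. blinfun_apply \<phi> y \<le> c) G}" for y
  define p where "p y = Inf (S y)" for y
  have norm_S: "norm y \<in> S y" for y
    unfolding S_def using ball by (auto elim!: eventually_mono intro: dual_apply_le)
  have lower: "- norm y \<le> c" if "c \<in> S y" for c y
  proof -
    have "eventually (\<lambda>\<phi>. blinfun_apply \<phi> y \<le> c \<and> norm \<phi> \<le> 1) G"
      using that ball by (auto simp: S_def intro: eventually_conj)
    then obtain \<phi> where \<phi>: "blinfun_apply \<phi> y \<le> c" "norm \<phi> \<le> 1"
      using G eventually_happens by blast
    then show ?thesis
      using dual_apply_le[OF \<phi>(2), of "- y"] by (simp add: blinfun.minus_right)
  qed
  have bdd: "bdd_below (S y)" for y
    using lower by (intro bdd_belowI) auto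
  have p_le: "p y \<le> c" if "c \<in> S y" for c y
    unfolding p_def using that bdd by (rule cInf_lower)
  have le_p: "c \<le> p y" if "\<And>d. d \<in> S y \<Longrightarrow> c \<le> d" for c y
    unfolding p_def using norm_S[of y] that by (intro cInf_greatest) auto
  have sub: "p (x + y) \<le> p x + p y" for x y
  proof -
    have "p (x + y) - d \<le> p x" if d: "d \<in> S y" for d
    proof (rule le_p)
      fix c assume c: "c \<in> S x"
      have "eventually (\<lambda>\<phi>. blinfun_apply \<phi> x \<le> c \<and> blinfun_apply \<phi> y \<le> d) G"
        using c d by (auto simp: S_def intro: eventually_conj)
      then have "c + d \<in> S (x + y)"
        unfolding S_def by (auto simp: blinfun.add_right elim!: eventually_mono)
      then show "p (x + y) - d \<le> c" using p_le by fastforce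
    qed
    then have "p (x + y) - p x \<le> p y" by (intro le_p) (simp add: algebra_simps)
    then show ?thesis by simp
  qed
  have hom: "p (a *\<^sub>R x) \<le> a * p x" if a: "a > 0" for a x
  proof -
    have "p (a *\<^sub>R x) / a \<le> p x"
    proof (rule le_p)
      fix c assume "c \<in> S x"
      then have "a * c \<in> S (a *\<^sub>R x)"
        using a by (simp add: S_def blinfun.scaleR_right)
      then show "p (a *\<^sub>R x) / a \<le> c"
        using p_le a by (simp add: field_simps)
    qed
    then show ?thesis using a by (simp add: field_simps)
  qed
  have "sublinear p" using sub hom by (simp add: sublinear_def)
  moreover have "p y \<le> norm y" for y using p_le[OF norm_S] .
  ultimately obtain v :: "'b dual" where v: "norm v \<le> 1" "\<And>y. v y \<le> p y"
    using dominated_functional by blast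
  show thesis
  proof
    show "norm v \<le> 1" by (rule v)
    show "blinfun_apply v y \<le> c" if "eventually (\<lambda>\<phi>. blinfun_apply \<phi> y \<le> c) G" for y c
      using v(2)[of y] p_le[of c y] that by (simp add: S_def)
  qed
qed

section \<open>Weak neighbourhoods and Goldstine's theorem\<close>

lemma norm_canonical_embedding_le: "norm (canonical_embedding x) \<le> norm x"
proof (rule norm_blinfun_bound)
  show "norm (blinfun_apply (canonical_embedding x) f) \<le> norm x * norm f" for f
    using norm_blinfun[of f x] by (simp add: mult.commute)
qed simp

lemma le_norm_canonical_embedding_add:
  assumes "norm f \<le> 1"
  shows "blinfun_apply v f + blinfun_apply f x \<le> norm (canonical_embedding x + v)"
proof -
  let ?w = "canonical_embedding x + v"
  have "blinfun_apply v f + blinfun_apply f x = blinfun_apply ?w f"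
    by (simp add: blinfun.add_left)
  also have "\<dots> \<le> norm ?w * norm f"
    using norm_blinfun[of ?w f] by simp
  also have "\<dots> \<le> norm ?w"
    using mult_left_mono[OF assms norm_ge_zero[of ?w]] by simp
  finally show ?thesis .
qed

text \<open>Both the weak and the weak-star topology are topologies of pointwise convergence, pulled back
  along an evaluation map \<open>T\<close>; their basic neighbourhoods are treated together.\<close>

lemma pullback_neighbourhood:
  fixes T :: "'c \<Rightarrow> 'd \<Rightarrow> real"
  assumes W: "openin (subtopology (pullback_topology UNIV T euclidean) B) W" and w: "w \<in> W"
  obtains F \<delta> where "finite F" "\<delta> > 0" "{u \<in> B. \<forall>f\<in>F. \<bar>T u f - T w f\<bar> < \<delta>} \<subseteq> W"
proof -
  obtain U where U: "open U" "W = T -` U \<inter> B"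
    using W by (auto simp: openin_subtopology openin_pullback_topology)
  have "openin (product_topology (\<lambda>i. euclidean) UNIV) U" "T w \<in> U"
    using U w by (auto simp: open_fun_def)
  from product_topology_open_contains_basis[OF this]
  obtain X where X: "\<And>i. T w i \<in> X i" "\<And>i. open (X i)" "finite {i. X i \<noteq> UNIV}"
    "{h. \<forall>i. h i \<in> X i} \<subseteq> U"
    by (auto simp: PiE_UNIV_domain Pi_def)
  have "\<exists>d>0. \<forall>r. \<bar>r - T w i\<bar> < d \<longrightarrow> r \<in> X i" for i
    using X(1,2)[of i] by (auto simp: open_dist dist_real_def)
  then obtain d where d: "\<And>i. d i > 0" "\<And>i r. \<bar>r - T w i\<bar> < d i \<Longrightarrow> r \<in> X i"
    by metis
  define F where "F = {i. X i \<noteq> UNIV}"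
  show thesis
  proof
    show F: "finite F" using X(3) by (simp add: F_def)
    show "Min (insert 1 (d ` F)) > 0" using F d(1) by auto
    show "{u \<in> B. \<forall>f\<in>F. \<bar>T u f - T w f\<bar> < Min (insert 1 (d ` F))} \<subseteq> W"
    proof clarify
      fix u assume u: "u \<in> B" "\<forall>f\<in>F. \<bar>T u f - T w f\<bar> < Min (insert 1 (d ` F))"
      have "T u i \<in> X i" for i
      proof (cases "i \<in> F")
        case True
        then have "Min (insert 1 (d ` F)) \<le> d i" using F by (intro Min_le) auto
        then show ?thesis using u(2) True by (intro d(2)) fastforce
      qed (simp add: F_def)
      then show "u \<in> W" using X(4) u(1) by (auto simp: U(2))
    qed
  qed
qed

lemma pullback_basic_open:
  fixes T :: "'c \<Rightarrow> 'd \<Rightarrow> real"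
  assumes "finite F"
  shows "openin (subtopology (pullback_topology UNIV T euclidean) B)
    {u \<in> B. \<forall>f\<in>F. \<bar>T u f - c f\<bar> < \<delta>}"
proof -
  have "open {h :: 'd \<Rightarrow> real. \<forall>f\<in>F. h f \<in> ball (c f) \<delta>}"
    using product_topology_basis'[OF assms, of "\<lambda>f. ball (c f) \<delta>" id] by simp
  then have "openin (pullback_topology UNIV T euclidean) (T -` {h. \<forall>f\<in>F. h f \<in> ball (c f) \<delta>})"
    unfolding openin_pullback_topology open_openin[symmetric] by blast
  moreover have "{u \<in> B. \<forall>f\<in>F. \<bar>T u f - c f\<bar> < \<delta>} = B \<inter> T -` {h. \<forall>f\<in>F. h f \<in> ball (c f) \<delta>}"
    by (auto simp: dist_real_def abs_minus_commute)
  ultimately show ?thesis by (simp only: openin_subtopology_Int2)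
qed

text \<open>Minimise \<open>Q y = (\<Sum>f\<in>F. (v f - f y)\<^sup>2)\<close> over the unit ball: at an almost
  minimal \<open>y\<close>, the functional \<open>g = (\<Sum>f\<in>F. (v f - f y) *\<^sub>R f)\<close>, which is half the negative gradient of
  \<open>Q\<close>, almost attains its norm at \<open>y\<close>.  Since \<open>v g \<le> norm g\<close>, this makes
  \<open>Q y = v g - g y\<close> almost nonpositive.\<close>

theorem Goldstine:
  fixes v :: "'a::real_normed_vector bidual"
  assumes F: "finite F" and v: "norm v \<le> 1" and \<delta>: "\<delta> > 0"
  obtains y where "y \<in> cball 0 1" "\<And>f. f \<in> F \<Longrightarrow> \<bar>blinfun_apply f y - v f\<bar> < \<delta>"
proof -
  define Q where "Q y = (\<Sum>f\<in>F. (v f - blinfun_apply f y)\<^sup>2)" for y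
  define m where "m = (INF y\<in>cball 0 1. Q y)"
  define M where "M = (\<Sum>f\<in>F. (2 * norm f)\<^sup>2)"
  have Q0: "Q y \<ge> 0" for y unfolding Q_def by (simp add: sum_nonneg)
  have bdd: "bdd_below (Q ` cball 0 1)" using Q0 by (intro bdd_belowI[of _ 0]) auto
  have m_le: "m \<le> Q y" if "norm y \<le> 1" for y
    unfolding m_def using bdd that by (intro cINF_lower) auto
  have close: "\<exists>y. norm y \<le> 1 \<and> Q y < m + \<eta>" if "\<eta> > 0" for \<eta>
  proof -
    have "(INF y\<in>cball 0 1. Q y) < m + \<eta>" using that by (simp add: m_def)
    moreover have "cball (0::'a) 1 \<noteq> {}" by simp
    ultimately show ?thesis using bdd by (subst (asm) cINF_less_iff) auto
  qed
  have small: "m \<le> t * (1 + M) / 2" if t: "0 < t" "t \<le> 1" for t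
  proof -
    obtain y where y: "norm y \<le> 1" "Q y < m + t\<^sup>2" using close[of "t\<^sup>2"] t by auto
    define g where "g = (\<Sum>f\<in>F. (v f - blinfun_apply f y) *\<^sub>R f)"
    have g_apply: "blinfun_apply g z = (\<Sum>f\<in>F. (v f - blinfun_apply f y) * blinfun_apply f z)" for z
      unfolding g_def by (simp add: blinfun.sum_left blinfun.scaleR_left)
    have step: "blinfun_apply g z \<le> blinfun_apply g y + t * (1 + M) / 2" if z: "norm z \<le> 1" for z
    proof -
      define q where "q = y + t *\<^sub>R (z - y)"
      have "q = (1 - t) *\<^sub>R y + t *\<^sub>R z" by (simp add: q_def algebra_simps)
      then have "norm q \<le> (1 - t) * norm y + t * norm z"
        using norm_triangle_ineq[of "(1 - t) *\<^sub>R y" "t *\<^sub>R z"] t by simp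
      also have "\<dots> \<le> (1 - t) * 1 + t * 1"
        using t y z by (intro add_mono mult_left_mono) auto
      finally have q1: "norm q \<le> 1" by simp
      have "Q q = (\<Sum>f\<in>F. (v f - blinfun_apply f y)\<^sup>2
          - 2 * t * ((v f - blinfun_apply f y) * blinfun_apply f (z - y)) + t\<^sup>2 * (blinfun_apply f (z - y))\<^sup>2)"
        unfolding Q_def
      proof (intro sum.cong refl)
        fix f
        have "blinfun_apply f q = blinfun_apply f y + t * blinfun_apply f (z - y)"
          by (simp only: q_def blinfun.add_right blinfun.scaleR_right real_scaleR_def)
        then show "(v f - blinfun_apply f q)\<^sup>2 = (v f - blinfun_apply f y)\<^sup>2
            - 2 * t * ((v f - blinfun_apply f y) * blinfun_apply f (z - y)) + t\<^sup>2 * (blinfun_apply f (z - y))\<^sup>2"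
          by (simp only: power2_eq_square) (simp add: algebra_simps)
      qed
      also have "\<dots> = Q y - 2 * t * blinfun_apply g (z - y) + t\<^sup>2 * (\<Sum>f\<in>F. (blinfun_apply f (z - y))\<^sup>2)"
        by (simp add: Q_def g_apply sum.distrib sum_subtractf sum_distrib_left)
      also have "\<dots> \<le> Q y - 2 * t * blinfun_apply g (z - y) + t\<^sup>2 * M"
      proof -
        have "(blinfun_apply f (z - y))\<^sup>2 \<le> (2 * norm f)\<^sup>2" for f :: "'a dual"
        proof -
          have "norm (z - y) \<le> 2" using y z norm_triangle_ineq4[of z y] by linarith
          then have "\<bar>blinfun_apply f (z - y)\<bar> \<le> norm f * 2"
            using norm_blinfun[of f "z - y"] mult_left_mono[of "norm (z - y)" 2 "norm f"] by simp
          then show ?thesis by (intro power2_le_iff_abs_le[THEN iffD2]) auto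
        qed
        then show ?thesis unfolding M_def using t by (intro add_left_mono mult_left_mono sum_mono) auto
      qed
      finally have "2 * t * blinfun_apply g (z - y) \<le> t\<^sup>2 * (1 + M)"
        using m_le[OF q1] y(2) by (simp add: algebra_simps)
      then have "t * (2 * blinfun_apply g (z - y)) \<le> t * (t * (1 + M))"
        by (simp add: power2_eq_square algebra_simps)
      then have "2 * blinfun_apply g (z - y) \<le> t * (1 + M)"
        using t by (simp only: mult_le_cancel_left_pos)
      then show ?thesis by (simp add: blinfun.diff_right)
    qed
    have "norm g \<le> blinfun_apply g y + t * (1 + M) / 2"
      using step by (rule dual_norm_le)
    moreover have "v g - blinfun_apply g y = Q y"
    proof -
      have "v g = (\<Sum>f\<in>F. (v f - blinfun_apply f y) * v f)"
        unfolding g_def by (simp add: blinfun.sum_right blinfun.scaleR_right)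
      then show ?thesis
        by (simp add: g_apply Q_def power2_eq_square right_diff_distrib sum_subtractf)
    qed
    ultimately show ?thesis
      using dual_apply_le[OF v, of g] m_le[OF y(1)] by linarith
  qed
  have "M \<ge> 0" unfolding M_def by (simp add: sum_nonneg)
  have "m \<le> 0"
  proof (rule field_le_epsilon)
    fix e :: real assume e: "e > 0"
    define t where "t = min 1 (e / (1 + M))"
    have "m \<le> t * (1 + M) / 2" using e \<open>M \<ge> 0\<close> by (intro small) (auto simp: t_def)
    also have "\<dots> \<le> (e / (1 + M)) * (1 + M) / 2"
      using \<open>M \<ge> 0\<close> by (intro divide_right_mono mult_right_mono) (auto simp: t_def)
    also have "\<dots> \<le> e" using \<open>M \<ge> 0\<close> e by simp
    finally show "m \<le> 0 + e" by simp
  qed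
  then obtain y where y: "norm y \<le> 1" "Q y < \<delta>\<^sup>2" using close[of "\<delta>\<^sup>2"] \<delta> by force
  show thesis
  proof
    show "y \<in> cball 0 1" using y by simp
    fix f assume "f \<in> F"
    then have "(v f - blinfun_apply f y)\<^sup>2 \<le> Q y"
      unfolding Q_def using F by (intro member_le_sum) auto
    then have "\<bar>v f - blinfun_apply f y\<bar>\<^sup>2 < \<delta>\<^sup>2" using y by simp
    then show "\<bar>blinfun_apply f y - v f\<bar> < \<delta>"
      using \<delta> power2_less_imp_less[of _ \<delta>] by (simp add: abs_minus_commute)
  qed
qed

section \<open>One step: an almost L-orthogonal functional with countably many prescribed values\<close>

text \<open>The Daugavet property speaks of unit vectors.  For \<open>norm s \<ge> 1\<close> the rest follows by scaling both
  vectors up and removing a multiple of \<open>y\<close>, at the price of the factor \<open>norm s\<close> in the error; for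
  \<open>norm s \<le> 1\<close> one shortens the unit vector in the direction of \<open>s\<close> instead.  The point \<open>z\<close> supplies a direction when
  \<open>s = 0\<close>.\<close>

lemma daugavet_add_vector:
  fixes s :: "'a::real_normed_vector"
  assumes dp: "daugavet_property TYPE('a)" and z: "(z::'a) \<noteq> 0"
    and W: "openin (subtopology weak_topology (cball 0 1)) W" "W \<noteq> {}" and \<delta>: "\<delta> > 0"
  shows "\<exists>y\<in>W. norm (s + y) > norm s + 1 - \<delta>"
proof -
  define a where "a = norm s"
  have a0: "a \<ge> 0" by (simp add: a_def)
  define u where "u = (if s = 0 then z /\<^sub>R norm z else s /\<^sub>R norm s)"
  have u: "norm u = 1" "s = a *\<^sub>R u" using z by (auto simp: u_def a_def)
  define d where "d = \<delta> / (1 + a)"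
  have d: "d > 0" "d \<le> \<delta>" "a * d \<le> \<delta>" using \<delta> a0 by (auto simp: d_def field_simps)
  obtain y where y: "y \<in> W" "norm (u + y) > 2 - d"
    using dp W d(1) u(1) unfolding daugavet_property_def by force
  have y1: "norm y \<le> 1" using openin_imp_subset[OF W(1)] y(1) by auto
  have "norm (s + y) > a + 1 - \<delta>"
  proof (cases "a \<le> 1")
    case True
    have "u + y = (s + y) + (1 - a) *\<^sub>R u" by (simp add: u(2) algebra_simps)
    then have "norm (u + y) \<le> norm (s + y) + norm ((1 - a) *\<^sub>R u)"
      by (metis norm_triangle_ineq)
    then have "norm (u + y) \<le> norm (s + y) + (1 - a)"
      using True u(1) by simp
    then show ?thesis using y(2) d(2) by linarith
  next
    case False
    have "a *\<^sub>R (u + y) = (s + y) + (a - 1) *\<^sub>R y" by (simp add: u(2) algebra_simps)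
    then have "norm (a *\<^sub>R (u + y)) \<le> norm (s + y) + norm ((a - 1) *\<^sub>R y)"
      by (metis norm_triangle_ineq)
    then have 1: "a * norm (u + y) \<le> norm (s + y) + (a - 1) * norm y"
      using False a0 by simp
    have 2: "(a - 1) * norm y \<le> a - 1"
      using False y1 mult_left_mono[of "norm y" 1 "a - 1"] by simp
    have "a * (2 - d) < a * norm (u + y)"
      using False y(2) by (intro mult_strict_left_mono) auto
    then have 3: "2 * a - a * d < a * norm (u + y)" by (simp add: algebra_simps)
    show ?thesis using 1 2 3 d(3) by linarith
  qed
  then show ?thesis using y(1) by (auto simp: a_def)
qed

text \<open>Enumerate \<open>F\<close> and choose \<open>y n\<close> in the unit ball so that \<open>f (y n)\<close> converges to \<open>v0 f\<close> for every
  \<open>f \<in> F\<close> and the norm of the partial sums \<open>x + y 0 + \<dots> + y (n - 1)\<close> stays within \<open>\<epsilon> / 2\<close> of its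
  largest possible value.  Both requirements are compatible because the first one leaves a non-empty
  weakly open set.  A generalized limit \<open>g\<close> of functionals norming the partial sums is then
  simultaneously large at \<open>x\<close> and at all \<open>y n\<close>, so that a generalized limit \<open>v\<close> of the \<open>y n\<close> in the bidual
  is large at \<open>g\<close>.  Choosing the \<open>y n\<close> independently of each other would not do: the norm of the bidual
  is only lower semicontinuous for the weak-star topology, and \<open>norm (x + y n)\<close> being large for every
  \<open>n\<close> says nothing about the limit without a common witness \<open>g\<close>.\<close>

lemma L_orthogonal_extension:
  fixes x :: "'a::real_normed_vector" and v0 :: "'a bidual"
  assumes dp: "daugavet_property TYPE('a)" and z: "(z::'a) \<noteq> 0"
    and v0: "norm v0 \<le> 1" and F: "countable F" and \<epsilon>: "\<epsilon> > 0"
  obtains v :: "'a bidual" and g :: "'a dual"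
  where "norm v \<le> 1" "\<And>f. f \<in> F \<Longrightarrow> v f = v0 f" "norm g \<le> 1" "v g + g x \<ge> 1 + norm x - \<epsilon>"
proof -
  define e where "e = from_nat_into (insert 0 F)"
  have range_e: "range e = insert 0 F"
    unfolding e_def using F by (intro range_from_nat_into) auto
  define W where
    "W n = {y \<in> cball 0 1. \<forall>f\<in>e ` {..n}. \<bar>blinfun_apply f y - v0 f\<bar> < 1 / real (Suc n)}" for n
  have W_open: "openin (subtopology weak_topology (cball 0 1)) (W n)" for n
    unfolding W_def weak_topology_def by (intro pullback_basic_open) auto
  have W_ne: "W n \<noteq> {}" for n
  proof -
    obtain y where "y \<in> cball 0 1" "\<And>f. f \<in> e ` {..n} \<Longrightarrow> \<bar>blinfun_apply f y - v0 f\<bar> < 1 / real (Suc n)"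
      using Goldstine[of "e ` {..n}" v0 "1 / real (Suc n)"] v0 by auto
    then show ?thesis by (auto simp: W_def)
  qed
  \<comment> \<open>the error \<open>\<epsilon> / 2 ^ (n + 2)\<close> permitted when adding \<open>y n\<close> adds up to at most \<open>\<epsilon> / 2\<close>\<close>
  define b where "b n = norm x + real n - (\<epsilon> / 2) * (1 - 1 / 2 ^ n)" for n
  have "\<exists>s. \<forall>n. (norm (s n) \<ge> b n \<and> (n = 0 \<longrightarrow> s n = x)) \<and> s (Suc n) - s n \<in> W n"
  proof (rule dependent_nat_choice)
    show "\<exists>y. norm y \<ge> b 0 \<and> (0 = (0::nat) \<longrightarrow> y = x)"
      by (intro exI[of _ x]) (simp add: b_def)
    fix s n assume s: "norm s \<ge> b n \<and> (n = 0 \<longrightarrow> s = x)"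
    obtain y where y: "y \<in> W n" "norm (s + y) > norm s + 1 - \<epsilon> / 2 ^ (n + 2)"
      using daugavet_add_vector[OF dp z W_open W_ne, of "\<epsilon> / 2 ^ (n + 2)" n s] \<epsilon> by auto
    have "b (Suc n) = b n + 1 - \<epsilon> / 2 ^ (n + 2)"
      by (simp add: b_def field_simps)
    then show "\<exists>t. (norm t \<ge> b (Suc n) \<and> (Suc n = 0 \<longrightarrow> t = x)) \<and> t - s \<in> W n"
      using s y by (intro exI[of _ "s + y"]) auto
  qed
  then obtain s where s: "\<And>n. norm (s n) \<ge> b n" "s 0 = x" "\<And>n. s (Suc n) - s n \<in> W n"
    by blast
  define y where "y n = s (Suc n) - s n" for n
  have y1: "norm (y n) \<le> 1" for n using s(3)[of n] by (simp add: y_def W_def)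
  have s_lower: "norm (s n) \<ge> norm x + real n - \<epsilon> / 2" for n
  proof -
    have "(\<epsilon> / 2) * (1 - 1 / 2 ^ n) \<le> (\<epsilon> / 2) * 1" using \<epsilon> by (intro mult_left_mono) auto
    then show ?thesis using s(1)[of n] unfolding b_def by linarith
  qed
  have "\<exists>G :: 'a dual. norm G \<le> 1 \<and> blinfun_apply G (s n) = norm (s n)" for n
    using norming_functional[of "s n"] by metis
  then obtain G :: "nat \<Rightarrow> 'a dual" where G: "\<And>n. norm (G n) \<le> 1" "\<And>n. blinfun_apply (G n) (s n) = norm (s n)"
    by metis
  have diff: "blinfun_apply (G n) (s j) - blinfun_apply (G n) (s i) \<le> real (j - i)" if "i \<le> j" for n i j
    using that
  proof (induction j rule: dec_induct)
    case (step j)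
    have "blinfun_apply (G n) (s (Suc j)) - blinfun_apply (G n) (s j) \<le> 1"
      using dual_apply_le[OF G(1), of n "y j"] y1[of j] by (simp add: y_def blinfun.diff_right)
    then show ?case using step by (simp add: Suc_diff_le)
  qed simp
  \<comment> \<open>\<open>s n\<close> is a sum of \<open>x\<close> and \<open>n\<close> vectors of the unit ball, and \<open>G n\<close> almost attains the largest
    possible value at the sum, so it does at each summand\<close>
  have G_x: "blinfun_apply (G n) x \<ge> norm x - \<epsilon> / 2" for n
    using diff[of 0 n n] G(2)[of n] s_lower[of n] s(2) by simp
  have G_y: "blinfun_apply (G n) (y i) \<ge> 1 - \<epsilon> / 2" if "i < n" for i n
  proof -
    have "blinfun_apply (G n) (s n) - blinfun_apply (G n) (s (Suc i)) \<le> real (n - Suc i)" "blinfun_apply (G n) (s i) - blinfun_apply (G n) x \<le> real i"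
      using diff[of "Suc i" n n] diff[of 0 i n] that s(2) by auto
    moreover have "real (n - Suc i) = real n - 1 - real i" using that by (simp add: of_nat_diff)
    moreover have "blinfun_apply (G n) x \<le> norm x" using G(1) by (rule dual_apply_le)
    ultimately show ?thesis
      using G(2)[of n] s_lower[of n] by (simp add: y_def blinfun.diff_right)
  qed
  have "filtermap G sequentially \<noteq> bot" by (simp add: filtermap_bot_iff)
  from generalized_limit[OF this] obtain g :: "'a dual" where g: "norm g \<le> 1"
    "\<And>q c. eventually (\<lambda>n. blinfun_apply (G n) q \<le> c) sequentially \<Longrightarrow> g q \<le> c"
    using G(1) by (auto simp: eventually_filtermap)
  have "g (- x) \<le> - (norm x - \<epsilon> / 2)"
  proof (intro g(2) always_eventually allI)
    show "blinfun_apply (G n) (- x) \<le> - (norm x - \<epsilon> / 2)" for n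
      using G_x[of n] by (simp add: blinfun.minus_right)
  qed
  then have g_x: "g x \<ge> norm x - \<epsilon> / 2" by (simp add: blinfun.minus_right)
  have g_y: "g (y i) \<ge> 1 - \<epsilon> / 2" for i
  proof -
    have "g (- y i) \<le> - (1 - \<epsilon> / 2)"
    proof (rule g(2))
      show "eventually (\<lambda>n. blinfun_apply (G n) (- y i) \<le> - (1 - \<epsilon> / 2)) sequentially"
        using eventually_gt_at_top[of i]
      proof eventually_elim
        case (elim n)
        show ?case using G_y[OF elim] by (simp add: blinfun.minus_right)
      qed
    qed
    then show ?thesis by (simp add: blinfun.minus_right)
  qed
  define Y where "Y n = canonical_embedding (y n)" for n
  have Y1: "norm (Y n) \<le> 1" for n
    using norm_canonical_embedding_le[of "y n"] y1[of n] by (simp add: Y_def)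
  have "filtermap Y sequentially \<noteq> bot" by (simp add: filtermap_bot_iff)
  from generalized_limit[OF this] obtain v :: "'a bidual" where v: "norm v \<le> 1"
    "\<And>f c. eventually (\<lambda>n. blinfun_apply f (y n) \<le> c) sequentially \<Longrightarrow> v f \<le> c"
    using Y1 by (auto simp: eventually_filtermap Y_def)
  have "v (- g) \<le> - (1 - \<epsilon> / 2)"
  proof (intro v(2) always_eventually allI)
    show "blinfun_apply (- g) (y n) \<le> - (1 - \<epsilon> / 2)" for n
      using g_y[of n] by (simp add: blinfun.minus_left)
  qed
  then have v_g: "v g \<ge> 1 - \<epsilon> / 2" by (simp add: blinfun.minus_right)
  have v_F: "v f = v0 f" if f: "f \<in> F" for f
  proof -
    obtain k where k: "e k = f" using f range_e by (metis insertCI rangeE)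
    have ev: "eventually (\<lambda>n. \<bar>blinfun_apply f (y n) - v0 f\<bar> \<le> c) sequentially" if c: "c > 0" for c
    proof -
      obtain N where N: "1 / real (Suc N) < c" using c nat_approx_posE by blast
      show ?thesis
        using eventually_ge_at_top[of "max k N"]
      proof eventually_elim
        case (elim n)
        then have "\<bar>blinfun_apply f (y n) - v0 f\<bar> < 1 / real (Suc n)"
          using s(3)[of n] k by (auto simp: W_def y_def)
        also have "\<dots> \<le> 1 / real (Suc N)" using elim by (intro divide_left_mono) auto
        finally show ?case using N by simp
      qed
    qed
    have "v f \<le> v0 f + c" "v (- f) \<le> - v0 f + c" if "c > 0" for c
      using ev[OF that] by (auto intro!: v(2) elim!: eventually_mono simp: blinfun.minus_left)
    then have "v f \<le> v0 f" "v (- f) \<le> - v0 f"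
      by (auto intro: field_le_epsilon)
    then show ?thesis by (simp add: blinfun.minus_right)
  qed
  show thesis
    using that[OF v(1) v_F g(1)] v_g g_x by linarith
qed

section \<open>Transfinite recursion of length \<open>\<omega>\<^sub>1\<close>\<close>

text \<open>Choose members \<open>S i \<subseteq> A i\<close> of the family by transfinite recursion along \<open>r\<close>, decreasing in
  \<open>i\<close>.  Below each \<open>i\<close> there are countably many choices, so their intersection is again a member of
  the family and the recursion does not stop.\<close>

lemma transfinite_intersection:
  fixes r :: "'i rel" and K :: "'b set set"
  assumes r: "Well_order r" and cnt: "\<And>i. i \<in> Field r \<Longrightarrow> countable (underS r i)"
    and step: "\<And>i C. i \<in> Field r \<Longrightarrow> C \<in> K \<Longrightarrow> \<exists>C'\<in>K. C' \<subseteq> C \<inter> A i"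
    and countable_chain: "\<And>\<C>. \<C> \<subseteq> K \<Longrightarrow> \<C> \<noteq> {} \<Longrightarrow> countable \<C> \<Longrightarrow>
      (\<And>C D. C \<in> \<C> \<Longrightarrow> D \<in> \<C> \<Longrightarrow> C \<subseteq> D \<or> D \<subseteq> C) \<Longrightarrow> \<Inter>\<C> \<in> K"
    and chain: "\<And>\<C>. \<C> \<subseteq> K \<Longrightarrow> \<C> \<noteq> {} \<Longrightarrow>
      (\<And>C D. C \<in> \<C> \<Longrightarrow> D \<in> \<C> \<Longrightarrow> C \<subseteq> D \<or> D \<subseteq> C) \<Longrightarrow> \<Inter>\<C> \<noteq> {}"
    and K0: "K0 \<in> K"
  shows "\<exists>v\<in>K0. \<forall>i\<in>Field r. v \<in> A i"
proof -
  define P where "P S i C \<longleftrightarrow>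
    (i \<in> Field r \<longrightarrow> C \<in> K \<and> C \<subseteq> K0 \<inter> A i \<and> (\<forall>j\<in>underS r i. C \<subseteq> S j))" for S i C
  have total: "i = j \<or> i \<in> underS r j \<or> j \<in> underS r i" if "i \<in> Field r" "j \<in> Field r" for i j
    using r that by (auto simp: well_order_on_def linear_order_on_def total_on_def underS_def)
  have field: "j \<in> Field r" if "j \<in> underS r i" for i j
    using that by (auto simp: underS_def intro: FieldI1)
  have trans: "k \<in> underS r i" if "k \<in> underS r j" "j \<in> underS r i" for i j k
    using that r
    by (auto simp: underS_def well_order_on_def linear_order_on_def partial_order_on_def
        preorder_on_def antisym_def dest: transD)
  have is_chain: "C \<subseteq> D \<or> D \<subseteq> C"
    if CD: "C \<in> insert K0 (S ` J)" "D \<in> insert K0 (S ` J)" and J: "J \<subseteq> Field r"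
      and S: "\<And>j. j \<in> J \<Longrightarrow> P S j (S j)" for C D S J
  proof -
    have K0: "S j \<subseteq> K0" if "j \<in> J" for j using S[OF that] J that by (auto simp: P_def)
    have "S i \<subseteq> S j \<or> S j \<subseteq> S i" if "i \<in> J" "j \<in> J" for i j
    proof -
      have "i \<in> Field r" "j \<in> Field r" using that J by auto
      with total[of i j] S[OF that(1)] S[OF that(2)] show ?thesis unfolding P_def by blast
    qed
    then show ?thesis using CD K0 by blast
  qed
  have "\<exists>S. \<forall>i. P S i (S i)"
  proof (rule dependent_wf_choice)
    show "wf (r - Id)" using r by (simp add: well_order_on_def)
    show "P S i C = P T i C" if "\<And>j. (j, i) \<in> r - Id \<Longrightarrow> S j = T j" for S T i C
      using that by (auto simp: P_def underS_def)
    fix i S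
    assume IH: "\<And>j. (j, i) \<in> r - Id \<Longrightarrow> P S j (S j)"
    then have IH': "P S j (S j)" if "j \<in> underS r i" for j using that by (auto simp: underS_def)
    show "\<exists>C. P S i C"
    proof (cases "i \<in> Field r")
      case True
      have "\<Inter>(insert K0 (S ` underS r i)) \<in> K"
      proof (rule countable_chain)
        show "insert K0 (S ` underS r i) \<subseteq> K" using IH' K0 field by (auto simp: P_def)
        show "countable (insert K0 (S ` underS r i))" using cnt[OF True] by simp
        show "C \<subseteq> D \<or> D \<subseteq> C"
          if "C \<in> insert K0 (S ` underS r i)" "D \<in> insert K0 (S ` underS r i)" for C D
          using that by (rule is_chain) (auto intro: field IH')
      qed simp
      from step[OF True this] show ?thesis by (fastforce simp: P_def)
    qed (simp add: P_def)
  qed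
  then obtain S where S: "\<And>i. P S i (S i)" by blast
  have "\<Inter>(insert K0 (S ` Field r)) \<noteq> {}"
  proof (rule chain)
    show "insert K0 (S ` Field r) \<subseteq> K" using S K0 by (auto simp: P_def)
    show "C \<subseteq> D \<or> D \<subseteq> C" if "C \<in> insert K0 (S ` Field r)" "D \<in> insert K0 (S ` Field r)" for C D
      using that by (rule is_chain) (auto intro: S)
  qed simp
  then obtain v where "v \<in> K0" "\<And>i. i \<in> Field r \<Longrightarrow> v \<in> S i" by blast
  moreover have "S i \<subseteq> A i" if "i \<in> Field r" for i using S[of i] that by (simp add: P_def)
  ultimately show ?thesis by blast
qed

text \<open>For countable \<open>F\<close> these are the sets to which the recursion applies.  Each of them can be written
  with any of its elements in place of \<open>u\<close>; so once a chain of them has a common element, its intersection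
  is the agreement set of the union of the sets \<open>F\<close>, which is countable if the chain is.\<close>

definition agreement_set :: "'b::real_normed_vector dual set \<Rightarrow> 'b bidual \<Rightarrow> 'b bidual set" where
  "agreement_set F u = {v. norm v \<le> 1 \<and> (\<forall>f\<in>F. blinfun_apply v f = blinfun_apply u f)}"

lemma agreement_set_eq: "w \<in> agreement_set F u \<Longrightarrow> agreement_set F u = agreement_set F w"
  by (auto simp: agreement_set_def)

text \<open>A chain of non-empty sets generates a proper filter.  Along it \<open>\<phi> f\<close> is eventually constant
  for every \<open>f\<close> that a member of the chain prescribes, so a generalized limit has the prescribed values.\<close>

lemma agreement_chain_Inter_nonempty:
  fixes \<C> :: "'b::real_normed_vector bidual set set"
  assumes C: "\<And>C. C \<in> \<C> \<Longrightarrow> \<exists>F u. norm u \<le> 1 \<and> C = agreement_set F u"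
    and chain: "\<And>C D. C \<in> \<C> \<Longrightarrow> D \<in> \<C> \<Longrightarrow> C \<subseteq> D \<or> D \<subseteq> C" and ne: "\<C> \<noteq> {}"
  shows "\<Inter>\<C> \<noteq> {}"
proof -
  define G where "G = (INF C\<in>\<C>. principal C)"
  have ev: "eventually Q G \<longleftrightarrow> (\<exists>C\<in>\<C>. \<forall>v\<in>C. Q v)" for Q
    unfolding G_def
  proof (subst eventually_INF_base)
    show "\<exists>x\<in>\<C>. principal x \<le> inf (principal C) (principal D)" if "C \<in> \<C>" "D \<in> \<C>" for C D
      using chain[OF that] that by (auto simp: inf_absorb1 inf_absorb2)
  qed (use ne in \<open>auto simp: eventually_principal\<close>)
  have "G \<noteq> bot"
  proof
    assume "G = bot"
    then obtain C where "C \<in> \<C>" "C = {}" using ev[of "\<lambda>_. False"] by auto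
    then show False using C[of C] by (auto simp: agreement_set_def)
  qed
  moreover have "eventually (\<lambda>\<phi>. norm \<phi> \<le> 1) G"
    using ne C unfolding ev by (fastforce simp: agreement_set_def)
  ultimately obtain v where v: "norm v \<le> 1"
    "\<And>f c. eventually (\<lambda>\<phi>. blinfun_apply \<phi> f \<le> c) G \<Longrightarrow> blinfun_apply v f \<le> c"
    using generalized_limit[of G] by blast
  have "v \<in> C" if CC: "C \<in> \<C>" for C
  proof -
    obtain F u where u: "C = agreement_set F u" using C[OF CC] by blast
    have "v f = u f" if "f \<in> F" for f
    proof -
      have eq: "\<forall>w\<in>C. blinfun_apply w f = blinfun_apply u f"
        using that by (simp add: u agreement_set_def)
      have "blinfun_apply v f \<le> u f"
        by (intro v(2) ev[THEN iffD2] bexI[OF _ CC]) (simp add: eq)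
      moreover have "blinfun_apply v (- f) \<le> - u f"
        by (intro v(2) ev[THEN iffD2] bexI[OF _ CC]) (simp add: eq blinfun.minus_right)
      ultimately show ?thesis by (simp add: blinfun.minus_right)
    qed
    then show ?thesis using v(1) by (simp add: u agreement_set_def)
  qed
  then show ?thesis by blast
qed

text \<open>The indices are the pairs of a point \<open>d\<close> of a dense set and a tolerance \<open>1 / Suc n\<close>.  In a
  well-order of least type on a set of cardinality \<open>\<omega>\<^sub>1\<close> every proper initial segment is countable.\<close>

lemma omega1_indexing:
  assumes "dens TYPE('a::topological_space) =o omega1"
  obtains D :: "'a::topological_space set" and r :: "('a \<times> nat) rel"
  where "closure D = UNIV" "infinite D" "Well_order r" "Field r = D \<times> UNIV" "\<And>i. i \<in> Field r \<Longrightarrow> countable (underS r i)"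
proof -
  obtain D :: "'a set" where D: "closure D = UNIV" "dens TYPE('a) = |D|" using dens_attained by metis
  have D1: "|D| =o cardSuc natLeq" using assms D(2) by (simp add: omega1_def)
  have "natLeq \<le>o |D|"
    using cardSuc_ordLeq[OF natLeq_Card_order] D1 ordIso_symmetric ordLeq_ordIso_trans by blast
  then have inf: "infinite D" and "|UNIV :: nat set| \<le>o |D|"
    using infinite_iff_natLeq_ordLeq card_of_nat ordIso_ordLeq_trans by blast+
  then have "|D \<times> (UNIV :: nat set)| =o |D|" using card_of_Times_infinite by blast
  then have DN: "|D \<times> (UNIV :: nat set)| =o cardSuc natLeq" using D1 ordIso_transitive by blast
  show thesis
  proof
    show "closure D = UNIV" by (rule D)
    show "infinite D" by (rule inf)
    show "Well_order |D \<times> (UNIV :: nat set)|" by (rule card_of_Well_order)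
    show "Field |D \<times> (UNIV :: nat set)| = D \<times> UNIV" by (rule Field_card_of)
    fix i assume "i \<in> Field |D \<times> (UNIV :: nat set)|"
    then have "|underS |D \<times> (UNIV :: nat set)| i| <o |D \<times> (UNIV :: nat set)|"
      by (rule card_of_underS[OF card_of_Card_order])
    then have "|underS |D \<times> (UNIV :: nat set)| i| <o cardSuc natLeq"
      using DN ordLess_ordIso_trans by blast
    then show "countable (underS |D \<times> (UNIV :: nat set)| i)"
      using cardSuc_ordLeq_ordLess[OF natLeq_Card_order card_of_Card_order] countable_card_le_natLeq
      by blast
  qed
qed

section \<open>The two implications\<close>

text \<open>The recursion meets one condition \<open>norm (canonical_embedding d + v) \<ge> 1 + norm d - 1 / Suc n\<close> at a
  time.  A step preserves all earlier conditions because each of them is witnessed by the value of \<open>v\<close>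
  at a single functional, and that value is prescribed from then on.\<close>

lemma daugavet_imp_L_orthogonal:
  fixes W :: "'a::real_normed_vector bidual set"
  assumes dens: "dens TYPE('a) =o omega1" and dp: "daugavet_property TYPE('a)"
    and W: "openin (subtopology weak_star_topology (cball 0 1)) W" "W \<noteq> {}"
  shows "\<exists>v \<in> sphere 0 1 \<inter> W. \<forall>x :: 'a. norm (canonical_embedding x + v) = 1 + norm x"
proof -
  obtain D :: "'a set" and r :: "('a \<times> nat) rel" where D: "closure D = UNIV" and inf: "infinite D" and r: "Well_order r" "Field r = D \<times> UNIV"
    and cnt: "\<And>i. i \<in> Field r \<Longrightarrow> countable (underS r i)"
    using omega1_indexing[OF dens] by blast
  have "\<not> D \<subseteq> {0}" using inf finite_subset by blast
  then obtain z :: 'a where z: "z \<noteq> 0" by blast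
  obtain w where w: "w \<in> W" using W(2) by blast
  have w1: "norm w \<le> 1" using openin_imp_subset[OF W(1)] w by auto
  obtain F \<delta> where F: "finite F" "\<delta> > 0" "{u \<in> cball 0 1. \<forall>f\<in>F. \<bar>blinfun_apply u f - w f\<bar> < \<delta>} \<subseteq> W"
    using pullback_neighbourhood[OF W(1)[unfolded strong_operator_topology_def] w] by blast
  define K where "K = {agreement_set H u |H u. countable H \<and> norm (u :: 'a bidual) \<le> 1}"
  define A where "A = (\<lambda>(x :: 'a, n). {v. norm (canonical_embedding x + v) \<ge> 1 + norm x - 1 / real (Suc n)})"
  have step: "\<exists>C'\<in>K. C' \<subseteq> C \<inter> A i" if CK: "C \<in> K" for C i
  proof -
    obtain x n where i: "i = (x, n)" by (cases i)
    obtain H and u :: "'a bidual" where C: "C = agreement_set H u" "countable H" "norm u \<le> 1"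
      using CK by (auto simp: K_def)
    obtain v :: "'a bidual" and g :: "'a dual" where v: "norm v \<le> 1" "\<And>f. f \<in> H \<Longrightarrow> v f = u f"
      "norm g \<le> 1" "v g + g x \<ge> 1 + norm x - 1 / real (Suc n)"
      using L_orthogonal_extension[OF dp z C(3,2), of "1 / real (Suc n)" x] by auto
    have "v' \<in> C \<inter> A i" if "v' \<in> agreement_set (insert g H) v" for v'
      using that v le_norm_canonical_embedding_add[OF v(3), of v' x]
      by (auto simp: agreement_set_def C A_def i)
    moreover have "agreement_set (insert g H) v \<in> K" using v(1) C(2) by (auto simp: K_def)
    ultimately show ?thesis by blast
  qed
  have chain: "\<Inter>\<C> \<noteq> {}"
    if "\<C> \<subseteq> K" "\<C> \<noteq> {}" "\<And>C D. C \<in> \<C> \<Longrightarrow> D \<in> \<C> \<Longrightarrow> C \<subseteq> D \<or> D \<subseteq> C" for \<C>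
    using that by (intro agreement_chain_Inter_nonempty) (auto simp: K_def)
  have countable_chain: "\<Inter>\<C> \<in> K"
    if \<C>: "\<C> \<subseteq> K" "\<C> \<noteq> {}" "countable \<C>" "\<And>C D. C \<in> \<C> \<Longrightarrow> D \<in> \<C> \<Longrightarrow> C \<subseteq> D \<or> D \<subseteq> C" for \<C>
  proof -
    obtain w where w: "\<And>C. C \<in> \<C> \<Longrightarrow> w \<in> C" using chain[OF \<C>(1,2,4)] by blast
    have "\<exists>H. countable H \<and> C = agreement_set H w" if CC: "C \<in> \<C>" for C
    proof -
      obtain H u where "countable H" "C = agreement_set H u" using \<C>(1) CC by (auto simp: K_def)
      then show ?thesis using agreement_set_eq w[OF CC] by blast
    qed
    then obtain H where H: "\<And>C. C \<in> \<C> \<Longrightarrow> countable (H C) \<and> C = agreement_set (H C) w"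
      by metis
    have mem: "v \<in> C \<longleftrightarrow> norm v \<le> 1 \<and> (\<forall>f\<in>H C. v f = w f)" if "C \<in> \<C>" for v C
      using H[OF that] by (auto simp: agreement_set_def)
    have "\<Inter>\<C> = agreement_set (\<Union>C\<in>\<C>. H C) w"
      using mem \<C>(2) by (auto simp: agreement_set_def)
    moreover have "countable (\<Union>C\<in>\<C>. H C)" using H \<C>(3) by auto
    moreover have "norm w \<le> 1" using mem w \<C>(2) by blast
    ultimately show ?thesis by (auto simp: K_def)
  qed
  have "agreement_set F w \<in> K" using F(1) w1 by (auto simp: K_def intro: countable_finite)
  have "\<exists>v\<in>agreement_set F w. \<forall>i\<in>Field r. v \<in> A i"
    using r(1) cnt step countable_chain chain \<open>agreement_set F w \<in> K\<close>
    by (rule transfinite_intersection)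
  then obtain v where v: "v \<in> agreement_set F w" and vA: "\<And>d n. d \<in> D \<Longrightarrow> v \<in> A (d, n)"
    unfolding r(2) by blast
  have v1: "norm v \<le> 1" and vW: "v \<in> W"
    using v F(2) subsetD[OF F(3), of v] by (auto simp: agreement_set_def)
  have dense: "1 + norm d \<le> norm (canonical_embedding d + v)" if d: "d \<in> D" for d
  proof (rule field_le_epsilon)
    fix e :: real assume "e > 0"
    then obtain n where "1 / real (Suc n) < e" using nat_approx_posE by blast
    then show "1 + norm d \<le> norm (canonical_embedding d + v) + e"
      using vA[OF d, of n] by (simp add: A_def)
  qed
  have "bounded_linear (canonical_embedding :: 'a \<Rightarrow> 'a bidual)"
  proof (rule bounded_linear_intro)
    show "norm (canonical_embedding x) \<le> norm x * 1" for x :: 'a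
      using norm_canonical_embedding_le[of x] by simp
  qed (auto intro!: blinfun_eqI simp: blinfun.bilinear_simps)
  then have cont: "continuous_on UNIV (canonical_embedding :: 'a \<Rightarrow> 'a bidual)"
    by (rule linear_continuous_on)
  have "closed {x. 1 + norm x \<le> norm (canonical_embedding x + v)}"
    by (intro closed_Collect_le continuous_intros cont)
  then have "closure D \<subseteq> {x. 1 + norm x \<le> norm (canonical_embedding x + v)}"
    by (intro closure_minimal) (auto intro: dense)
  then have ge: "1 + norm x \<le> norm (canonical_embedding x + v)" for x using D by blast
  have "norm (canonical_embedding x + v) \<le> 1 + norm x" for x
    using norm_triangle_ineq[of "canonical_embedding x" v] norm_canonical_embedding_le[of x] v1
    by linarith
  then have eq: "norm (canonical_embedding x + v) = 1 + norm x" for x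
    using ge by (intro antisym)
  have "canonical_embedding (0 :: 'a) = 0" by (rule blinfun_eqI) (simp add: blinfun.bilinear_simps)
  then have "norm v = 1" using eq[of 0] by simp
  then show ?thesis using vW eq by (intro bexI[of _ v]) auto
qed

text \<open>A basic weak neighbourhood is given by finitely many functionals, which also define a weak-star
  open subset of the bidual ball.  Goldstine's theorem replaces the functional \<open>v\<close> found there by a point
  \<open>y\<close> of the space, close to it at those functionals and at one that almost norms
  \<open>canonical_embedding x + v\<close>.  The open set uses \<open>\<delta> / 2\<close> to leave room for this approximation.\<close>

lemma L_orthogonal_imp_daugavet:
  assumes L: "\<And>W :: 'a::real_normed_vector bidual set.
      openin (subtopology weak_star_topology (cball 0 1)) W \<Longrightarrow> W \<noteq> {} \<Longrightarrow>
      \<exists>v \<in> sphere 0 1 \<inter> W. \<forall>x :: 'a. norm (canonical_embedding x + v) = 1 + norm x"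
  shows "daugavet_property TYPE('a)"
  unfolding daugavet_property_def
proof (intro ballI allI impI, elim conjE)
  fix x :: 'a and W :: "'a set" and \<epsilon> :: real
  assume x: "x \<in> sphere 0 1" and W: "openin (subtopology weak_topology (cball 0 1)) W" "W \<noteq> {}"
    and \<epsilon>: "\<epsilon> > 0"
  obtain w where w: "w \<in> W" using W(2) by blast
  obtain F :: "'a dual set" and \<delta> where F: "finite F" "\<delta> > 0"
    "{u \<in> cball 0 1. \<forall>f\<in>F. \<bar>blinfun_apply f u - blinfun_apply f w\<bar> < \<delta>} \<subseteq> W"
    using pullback_neighbourhood[OF W(1)[unfolded weak_topology_def] w] by blast
  define V where
    "V = {v \<in> cball 0 1. \<forall>f\<in>F. \<bar>blinfun_apply v f - blinfun_apply (canonical_embedding w) f\<bar> < \<delta> / 2}"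
  have "norm (canonical_embedding w) \<le> 1"
    using openin_imp_subset[OF W(1)] w norm_canonical_embedding_le[of w] by auto
  then have "canonical_embedding w \<in> V" using F(2) by (simp add: V_def)
  moreover have "openin (subtopology weak_star_topology (cball 0 1)) V"
    unfolding V_def strong_operator_topology_def by (rule pullback_basic_open[OF F(1)])
  ultimately obtain v where v: "v \<in> V" "norm (canonical_embedding x + v) = 1 + norm x"
    using L[of V] by blast
  have v1: "norm v \<le> 1" using v(1) by (simp add: V_def)
  obtain g where g: "norm g \<le> 1" "v g + blinfun_apply g x > 2 - \<epsilon> / 2"
  proof -
    let ?u = "canonical_embedding x + v"
    have "\<exists>g. norm g \<le> 1 \<and> blinfun_apply ?u g > 2 - \<epsilon> / 2"
    proof (rule ccontr)
      assume *: "\<nexists>g. norm g \<le> 1 \<and> blinfun_apply ?u g > 2 - \<epsilon> / 2"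
      have "norm ?u \<le> 2 - \<epsilon> / 2"
        using * by (intro dual_norm_le) (meson not_less)
      then show False using v(2) x \<epsilon> by simp
    qed
    then show thesis using that by (auto simp: blinfun.add_left add.commute)
  qed
  obtain y where y: "y \<in> cball 0 1"
    "\<And>f. f \<in> insert g F \<Longrightarrow> \<bar>blinfun_apply f y - v f\<bar> < min (\<delta> / 2) (\<epsilon> / 2)"
    using Goldstine[of "insert g F" v "min (\<delta> / 2) (\<epsilon> / 2)"] F(1,2) v1 \<epsilon> by auto
  have "\<bar>blinfun_apply f y - blinfun_apply f w\<bar> < \<delta>" if "f \<in> F" for f
  proof -
    have "\<bar>v f - blinfun_apply f w\<bar> < \<delta> / 2" using v(1) that by (simp add: V_def)
    moreover have "\<bar>blinfun_apply f y - v f\<bar> < \<delta> / 2" using y(2)[of f] that by simp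
    ultimately show ?thesis by linarith
  qed
  then have "y \<in> W" using F(3) y(1) by blast
  moreover have "\<bar>blinfun_apply g y - v g\<bar> < \<epsilon> / 2" using y(2)[of g] by simp
  then have "norm (x + y) > 2 - \<epsilon>"
    using dual_apply_le[OF g(1), of "x + y"] g(2) unfolding blinfun.add_right by linarith
  ultimately show "\<exists>y\<in>W. norm (x + y) > 2 - \<epsilon>" by blast
qed

theorem theorem3p6:
  assumes "dens TYPE('a::banach) =o omega1"
  shows "daugavet_property TYPE('a) \<longleftrightarrow>
    (\<forall>W :: 'a bidual set.
      openin (subtopology weak_star_topology (cball 0 1)) W \<and> W \<noteq> {} \<longrightarrow>
      (\<exists>v \<in> sphere 0 1 \<inter> W. \<forall>x :: 'a. norm (canonical_embedding x + v) = 1 + norm x))"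
  using daugavet_imp_L_orthogonal[OF assms] L_orthogonal_imp_daugavet by metis

end
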